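(* Let $B$ be a locale, let $X$ and $Y$ be étale $B$-locales, and let $f:X\to Y$ be a map of $B$-locales. Then $f_!=(f^* )^\dagger$ (equivalently, $f^*=(f_!)^\dagger$).
   Context: A locale is a frame; a homomorphism of locales preserves arbitrary joins and finite meets; a map of locales $f:X\to Y$ is a homomorphism $f^*:Y\to X$. A $B$-module is a complete lattice $X$ with an action $B\times X\to X$, $(b,x)\mapsto bx$, preserving arbitrary joins in each variable and satisfying $1x=x$ and $(b\wedge c)x=b(cx)$. A homomorphism of $B$-modules preserves arbitrary joins and the action. A $B$-locale is a locale $X$ equipped with a $B$-module structure such that $bx=b1\wedge x$ for all $b\in B$, $x\in X$. Its projection is the map of locales $p:X\to B$ with $p^*(b)=b1$. A map of $B$-locales $f:X\to Y$ is a function $f^*:Y\to X$ that is both a homomorphism of locales and a homomorphism of $B$-modules. A $B$-locale is open if $p^*$ has a left adjoint $\varsigma=p_!:X\to B$ which is a homomorphism of $B$-modules. A local section of an open $B$-locale $X$ is an $s\in X$ such that $\varsigma(x)s=x$ for all $x\le s$; $\mathit{\Gamma}_X$ is the set of local sections; $X$ is étale if $\bigvee\mathit{\Gamma}_X=1$ (equivalently, $p$ is a local homeomorphism). A map $f:X\to Y$ of $B$-locales between étale $B$-locales is a local homeomorphism; $f_!:X\to Y$ denotes the left adjoint of $f^*$. An étale $B$-locale $X$ is always regarded as a Hilbert $B$-module with inner product $\langle x,y\rangle=\varsigma(x\wedge y)\in B$ and Hilbert basis $\mathit{\Gamma}_X$ (that is, $x=\bigvee_{s\in\mathit{\Gamma}_X}\langle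 x,s\rangle s$ for all $x$). For a homomorphism of $B$-modules $h:X\to Y$ between étale $B$-locales, $h^\dagger:Y\to X$ denotes its unique adjoint with respect to the inner products: $\langle h(x),y\rangle=\langle x,h^\dagger(y)\rangle$ for all $x\in X$, $y\in Y$. *)

theory Defs
  imports Main
begin

unbundle lattice_syntax

(* Locales in the sense of pointless topology, i.e. frames.  The library class complete_distrib_lattice is complete distributivity,
   which is strictly stronger. *)
class frame = complete_lattice +
  assumes inf_Sup_frame: "x \<sqinter> \<Squnion>A = (\<Squnion>a\<in>A. x \<sqinter> a)"

definition frame_hom :: "('a::frame \<Rightarrow> 'c::frame) \<Rightarrow> bool" where
  "frame_hom h \<longleftrightarrow>
     (\<forall>A. h (\<Squnion>A) = \<Squnion>(h ` A)) \<and> (\<forall>x y. h (x \<sqinter> y) = h x \<sqinter> h y) \<and> h \<top> = \<top>"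

locale b_module =
  fixes act :: "'b::frame \<Rightarrow> 'x::complete_lattice \<Rightarrow> 'x"
  assumes act_Sup_left: "act (\<Squnion>C) x = (\<Squnion>c\<in>C. act c x)"
    and act_Sup_right: "act b (\<Squnion>A) = (\<Squnion>a\<in>A. act b a)"
    and act_top: "act \<top> x = x"
    and act_inf: "act (b \<sqinter> c) x = act b (act c x)"

definition b_module_hom ::
  "('b \<Rightarrow> 'x \<Rightarrow> 'x) \<Rightarrow> ('b \<Rightarrow> 'y \<Rightarrow> 'y) \<Rightarrow>
   ('x::complete_lattice \<Rightarrow> 'y::complete_lattice) \<Rightarrow> bool" where
  "b_module_hom actX actY h \<longleftrightarrow>
     (\<forall>A. h (\<Squnion>A) = \<Squnion>(h ` A)) \<and> (\<forall>b x. h (actX b x) = actY b (h x))"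

locale b_locale = b_module act
  for act :: "'b::frame \<Rightarrow> 'x::frame \<Rightarrow> 'x" +
  assumes act_eq: "act b x = act b \<top> \<sqinter> x"

definition is_left_adjoint :: "('x::order \<Rightarrow> 'y::order) \<Rightarrow> ('y \<Rightarrow> 'x) \<Rightarrow> bool" where
  "is_left_adjoint l r \<longleftrightarrow> (\<forall>x y. l x \<le> y \<longleftrightarrow> x \<le> r y)"

(* For a map of locales f, represented by r = f^*, this is f_!.  A left adjoint is unique if it
   exists; otherwise the value is unspecified. *)
definition left_adjoint :: "('y::order \<Rightarrow> 'x::order) \<Rightarrow> ('x \<Rightarrow> 'y)" where
  "left_adjoint r = (THE l. is_left_adjoint l r)"

(* The inverse image p^* of the projection p : X -> B. *)
definition proj_star :: "('b::frame \<Rightarrow> 'x::frame \<Rightarrow> 'x) \<Rightarrow> 'b \<Rightarrow> 'x" where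
  "proj_star act b = act b \<top>"

(* The support map varsigma = p_!, meaningful once p^* has a left adjoint. *)
definition supp :: "('b::frame \<Rightarrow> 'x::frame \<Rightarrow> 'x) \<Rightarrow> 'x \<Rightarrow> 'b" where
  "supp act = left_adjoint (proj_star act)"

(* As a module over itself, B acts by meet; existence of the left adjoint of p^* is the first
   assumption, since left adjoints are unique. *)
locale open_b_locale = b_locale act
  for act :: "'b::frame \<Rightarrow> 'x::frame \<Rightarrow> 'x" +
  assumes supp_left_adjoint: "is_left_adjoint (supp act) (proj_star act)"
    and supp_hom: "b_module_hom act (\<sqinter>) (supp act)"

definition local_sections :: "('b::frame \<Rightarrow> 'x::frame \<Rightarrow> 'x) \<Rightarrow> 'x set" where
  "local_sections act = {s. \<forall>x\<le>s. act (supp act x) s = x}"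

locale etale_b_locale = open_b_locale act
  for act :: "'b::frame \<Rightarrow> 'x::frame \<Rightarrow> 'x" +
  assumes Sup_local_sections: "\<Squnion>(local_sections act) = \<top>"

(* A map of B-locales f : X -> Y, represented by its inverse image fstar = f^* : Y -> X. *)
definition b_locale_map ::
  "('b \<Rightarrow> 'x \<Rightarrow> 'x) \<Rightarrow> ('b \<Rightarrow> 'y \<Rightarrow> 'y) \<Rightarrow> ('y::frame \<Rightarrow> 'x::frame) \<Rightarrow> bool" where
  "b_locale_map actX actY fstar \<longleftrightarrow> frame_hom fstar \<and> b_module_hom actY actX fstar"

definition inner :: "('b::frame \<Rightarrow> 'x::frame \<Rightarrow> 'x) \<Rightarrow> 'x \<Rightarrow> 'x \<Rightarrow> 'b" where
  "inner act x y = supp act (x \<sqinter> y)"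

definition is_hilbert_adjoint ::
  "('b::frame \<Rightarrow> 'x::frame \<Rightarrow> 'x) \<Rightarrow> ('b \<Rightarrow> 'y::frame \<Rightarrow> 'y) \<Rightarrow>
   ('x \<Rightarrow> 'y) \<Rightarrow> ('y \<Rightarrow> 'x) \<Rightarrow> bool" where
  "is_hilbert_adjoint actX actY h k \<longleftrightarrow> (\<forall>x y. inner actY (h x) y = inner actX x (k y))"

definition dagger ::
  "('b::frame \<Rightarrow> 'x::frame \<Rightarrow> 'x) \<Rightarrow> ('b \<Rightarrow> 'y::frame \<Rightarrow> 'y) \<Rightarrow> ('x \<Rightarrow> 'y) \<Rightarrow> ('y \<Rightarrow> 'x)" where
  "dagger actX actY h = (THE k. is_hilbert_adjoint actX actY h k)"

end

theory Submission
  imports Defs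
begin

text \<open>The Hilbert adjoint of \<open>f\<^sup>*\<close> is forced by the Hilbert basis of \<open>Y\<close>: it sends \<open>x\<close> to the join of
  \<open>\<langle>f\<^sup>*(t),x\<rangle>t\<close> over the local sections \<open>t\<close> of \<open>Y\<close>.  This map is also left adjoint to \<open>f\<^sup>*\<close>: the unit
  inequality holds because \<open>z \<le> \<sigma>(z)u\<close> whenever \<open>z \<le> u\<close>, together with the fact that the \<open>f\<^sup>*(t)\<close>
  cover \<open>X\<close>; the counit inequality holds because \<open>\<sigma>(f\<^sup>*(u)) \<le> \<sigma>(u)\<close> and \<open>\<sigma>(t \<sqinter> y)t = t \<sqinter> y\<close>.\<close>

lemma left_adjoint_eqI:
  assumes "is_left_adjoint l r"
  shows "left_adjoint r = l"
  unfolding left_adjoint_def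
proof (rule the_equality[where P = "\<lambda>l. is_left_adjoint l r", OF assms])
  fix l' assume "is_left_adjoint l' r"
  then show "l' = l"
    using assms unfolding is_left_adjoint_def by (meson antisym ext order_refl)
qed

lemma mono_if_Sup_preserving:
  fixes h :: "'a::complete_lattice \<Rightarrow> 'c::complete_lattice"
  assumes "\<And>A. h (\<Squnion>A) = \<Squnion>(h ` A)"
  shows "mono h"
proof
  fix x y :: 'a assume "x \<le> y"
  then have "h y = h x \<squnion> h y"
    using assms[of "{x, y}"] by (simp add: sup_absorb2)
  then show "h x \<le> h y" by (simp add: le_iff_sup)
qed

context b_locale
begin

lemma act_mono_left: "b \<le> c \<Longrightarrow> act b x \<le> act c x"
  using monoD[OF mono_if_Sup_preserving[of "\<lambda>b. act b x"]] act_Sup_left by simp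

lemma inf_act: "x \<sqinter> act b y = act b (x \<sqinter> y)"
  by (subst (1 2) act_eq) (simp add: inf.left_commute)

end

context open_b_locale
begin

lemma supp_le_iff: "supp act x \<le> b \<longleftrightarrow> x \<le> act b \<top>"
  using supp_left_adjoint by (simp add: is_left_adjoint_def proj_star_def)

lemma supp_Sup: "supp act (\<Squnion>A) = (\<Squnion>a\<in>A. supp act a)"
  using supp_hom by (simp add: b_module_hom_def)

lemma supp_act: "supp act (act b x) = b \<sqinter> supp act x"
  using supp_hom by (simp add: b_module_hom_def)

lemma supp_mono: "x \<le> y \<Longrightarrow> supp act x \<le> supp act y"
  using monoD[OF mono_if_Sup_preserving] supp_Sup by blast

text \<open>The unit of the adjunction between \<open>supp act\<close> and
  \<open>proj_star act\<close> bounds \<open>z\<close> by \<open>act (supp act z) \<top>\<close>;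
  meeting this with \<open>u\<close> gives the action on \<open>u\<close>.\<close>

lemma le_act_supp:
  assumes "z \<le> u"
  shows "z \<le> act (supp act z) u"
proof -
  have "z \<le> act (supp act z) \<top>" using supp_le_iff by blast
  with assms show ?thesis by (subst act_eq) simp
qed

lemma inner_commute: "inner act x y = inner act y x"
  by (simp add: inner_def inf.commute)

lemma inner_Sup_right: "inner act x (\<Squnion>A) = (\<Squnion>a\<in>A. inner act x a)"
  by (simp add: inner_def inf_Sup_frame supp_Sup image_image)

lemma inner_act_right: "inner act x (act b y) = b \<sqinter> inner act x y"
  by (simp add: inner_def inf_act supp_act)

end

context etale_b_locale
begin

text \<open>The defining property of a local section, applied to the element
  \<open>x \<sqinter> t\<close> below \<open>t\<close>.\<close>

lemma act_inner_local_section: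
  "t \<in> local_sections act \<Longrightarrow> act (inner act x t) t = x \<sqinter> t"
  by (simp add: local_sections_def inner_def)

lemma hilbert_basis: "x = (\<Squnion>t\<in>local_sections act. act (inner act x t) t)"
proof -
  have "x = x \<sqinter> \<Squnion>(local_sections act)" by (simp add: Sup_local_sections)
  also have "\<dots> = (\<Squnion>t\<in>local_sections act. act (inner act x t) t)"
    unfolding inf_Sup_frame by (rule SUP_cong) (simp_all add: act_inner_local_section)
  finally show ?thesis .
qed

text \<open>The basis expansion recovers an element from its inner products with local sections.
  This is what makes Hilbert adjoints unique.\<close>

lemma inner_nondegenerate:
  assumes "\<And>y. inner act y a = inner act y b"
  shows "a = b"
proof -
  have eq: "inner act a t = inner act b t" for t
    using assms inner_commute by metis
  have "a = (\<Squnion>t\<in>local_sections act. act (inner act a t) t)" by (rule hilbert_basis)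
  also have "\<dots> = b" unfolding eq by (rule hilbert_basis[symmetric])
  finally show ?thesis .
qed

end

lemma is_hilbert_adjoint_sym:
  assumes "open_b_locale actX" "open_b_locale actY"
    and "is_hilbert_adjoint actX actY h k"
  shows "is_hilbert_adjoint actY actX k h"
  using assms unfolding is_hilbert_adjoint_def by (metis open_b_locale.inner_commute)

lemma dagger_eqI:
  assumes "etale_b_locale actX" "is_hilbert_adjoint actX actY h k"
  shows "dagger actX actY h = k"
  unfolding dagger_def
proof (rule the_equality[where P = "is_hilbert_adjoint actX actY h", OF assms(2)])
  fix k' assume "is_hilbert_adjoint actX actY h k'"
  with assms(2) have "inner actX x (k' y) = inner actX x (k y)" for x y
    unfolding is_hilbert_adjoint_def by simp
  then show "k' = k"
    by (intro ext etale_b_locale.inner_nondegenerate[OF assms(1)])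
qed

locale etale_b_locale_map =
  X: etale_b_locale actX + Y: etale_b_locale actY
  for actX :: "'b::frame \<Rightarrow> 'x::frame \<Rightarrow> 'x"
    and actY :: "'b \<Rightarrow> 'y::frame \<Rightarrow> 'y" +
  fixes fstar :: "'y \<Rightarrow> 'x"
  assumes b_locale_map: "b_locale_map actX actY fstar"
begin

text \<open>If \<open>k\<close> is Hilbert adjoint to \<open>fstar\<close>, the coefficient of
  \<open>k x\<close> at \<open>t\<close> is \<open>inner actX x (fstar t)\<close>, so the basis
  expansion of \<open>k x\<close> must be this join.\<close>

definition direct_image :: "'x \<Rightarrow> 'y" where
  "direct_image x = (\<Squnion>t\<in>local_sections actY. actY (inner actX x (fstar t)) t)"

lemma fstar_Sup: "fstar (\<Squnion>A) = (\<Squnion>a\<in>A. fstar a)"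
  and fstar_inf: "fstar (x \<sqinter> y) = fstar x \<sqinter> fstar y"
  and fstar_top: "fstar \<top> = \<top>"
  and fstar_act: "fstar (actY b y) = actX b (fstar y)"
  using b_locale_map by (simp_all add: b_locale_map_def frame_hom_def b_module_hom_def)

lemma fstar_mono: "x \<le> y \<Longrightarrow> fstar x \<le> fstar y"
  using monoD[OF mono_if_Sup_preserving] fstar_Sup by blast

text \<open>\<open>fstar\<close> carries \<open>actY b \<top>\<close> to
  \<open>actX b \<top>\<close>, so the bound of \<open>u\<close> by its support transfers to
  \<open>fstar u\<close>.\<close>

lemma supp_fstar_le: "supp actX (fstar u) \<le> supp actY u"
proof -
  have "u \<le> actY (supp actY u) \<top>" using Y.supp_le_iff by blast
  then have "fstar u \<le> actX (supp actY u) \<top>"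
    using fstar_mono fstar_act fstar_top by metis
  then show ?thesis by (simp add: X.supp_le_iff)
qed

lemma le_fstar_direct_image: "x \<le> fstar (direct_image x)"
proof -
  have "x = x \<sqinter> fstar (\<Squnion>(local_sections actY))"
    by (simp add: Y.Sup_local_sections fstar_top)
  also have "\<dots> = (\<Squnion>t\<in>local_sections actY. x \<sqinter> fstar t)"
    by (simp add: fstar_Sup inf_Sup_frame image_image)
  \<comment> \<open>Termwise, with \<open>z = x \<sqinter> fstar t\<close> and
    \<open>u = fstar t\<close> in \<open>le_act_supp\<close>.\<close>
  also have "\<dots> \<le> (\<Squnion>t\<in>local_sections actY. actX (inner actX x (fstar t)) (fstar t))"
    unfolding inner_def by (rule SUP_mono') (simp add: X.le_act_supp)
  also have "\<dots> = fstar (direct_image x)"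
    by (simp add: direct_image_def fstar_Sup fstar_act image_image)
  finally show ?thesis .
qed

lemma direct_image_le:
  assumes "x \<le> fstar y"
  shows "direct_image x \<le> y"
  unfolding direct_image_def
proof (rule SUP_least)
  fix t assume t: "t \<in> local_sections actY"
  \<comment> \<open>Since \<open>fstar\<close> preserves binary meets,
    \<open>x \<sqinter> fstar t\<close> lies below \<open>fstar (y \<sqinter> t)\<close>.\<close>
  have "inner actX x (fstar t) \<le> supp actX (fstar (y \<sqinter> t))"
    unfolding inner_def fstar_inf using assms by (intro X.supp_mono inf_mono) simp_all
  also have "\<dots> \<le> inner actY y t"
    unfolding inner_def by (rule supp_fstar_le)
  finally have "actY (inner actX x (fstar t)) t \<le> actY (inner actY y t) t"
    by (rule Y.act_mono_left)
  also have "\<dots> \<le> y" using t by (simp add: Y.act_inner_local_section)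
  finally show "actY (inner actX x (fstar t)) t \<le> y" .
qed

lemma direct_image_left_adjoint: "is_left_adjoint direct_image fstar"
  unfolding is_left_adjoint_def
  using direct_image_le le_fstar_direct_image fstar_mono order_trans by blast

text \<open>Expanding \<open>y\<close> on one side and \<open>direct_image x\<close> on the other
  turns both inner products into the same join over the local sections of \<open>Y\<close>.\<close>

lemma direct_image_hilbert_adjoint: "is_hilbert_adjoint actY actX fstar direct_image"
  unfolding is_hilbert_adjoint_def
proof (intro allI)
  fix y x
  have "inner actX (fstar y) x
      = inner actX x (fstar (\<Squnion>t\<in>local_sections actY. actY (inner actY y t) t))"
    \<comment> \<open>The reversed expansion folds the join back to \<open>y\<close>, leaving only
      symmetry of the inner product.\<close>
    unfolding Y.hilbert_basis[of y, symmetric] by (rule X.inner_commute)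
  also have "\<dots> = (\<Squnion>t\<in>local_sections actY. inner actY y t \<sqinter> inner actX x (fstar t))"
    by (simp add: fstar_Sup fstar_act X.inner_Sup_right X.inner_act_right image_image)
  also have "\<dots> = inner actY y (direct_image x)"
    by (simp add: direct_image_def Y.inner_Sup_right Y.inner_act_right image_image inf.commute)
  finally show "inner actX (fstar y) x = inner actY y (direct_image x)" .
qed

end

theorem theorem4p8:
  fixes actX :: "'b::frame \<Rightarrow> 'x::frame \<Rightarrow> 'x"
    and actY :: "'b \<Rightarrow> 'y::frame \<Rightarrow> 'y"
    and fstar :: "'y \<Rightarrow> 'x"
  assumes "etale_b_locale actX"
    and "etale_b_locale actY"
    and "b_locale_map actX actY fstar"
  shows "is_left_adjoint (left_adjoint fstar) fstar
    \<and> is_hilbert_adjoint actY actX fstar (dagger actY actX fstar)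
    \<and> left_adjoint fstar = dagger actY actX fstar
    \<and> fstar = dagger actX actY (left_adjoint fstar)"
proof -
  interpret etale_b_locale_map actX actY fstar
    using assms by (simp add: etale_b_locale_map_def etale_b_locale_map_axioms_def)
  have "left_adjoint fstar = direct_image"
    by (rule left_adjoint_eqI[OF direct_image_left_adjoint])
  moreover have "dagger actY actX fstar = direct_image"
    by (rule dagger_eqI[OF assms(2) direct_image_hilbert_adjoint])
  \<comment> \<open>Adjointness is symmetric because the inner products are, so uniqueness applies
    in the other direction too.\<close>
  moreover have "dagger actX actY direct_image = fstar"
    by (rule dagger_eqI[OF assms(1) is_hilbert_adjoint_sym[OF Y.open_b_locale_axioms
        X.open_b_locale_axioms direct_image_hilbert_adjoint]])
  ultimately show ?thesis
    using direct_image_left_adjoint direct_image_hilbert_adjoint by simp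
qed

end
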